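(* Let $f:[0,\infty)\to\mathbb{R}$ be a superquadratic function, and let $C:[0,\infty)\to\mathbb{R}$ be a function such that $f(y)-f(x)\geq f(|y-x|)+C(x)(y-x)$ for all $x,y\in[0,\infty)$. Let $k,n_1,\dots,n_k$ be positive integers. For $i=1,\dots,k$ let $\mathbf{p}_i=(p_{i1},\dots,p_{in_i})$ have positive real entries with $\sum_{j=1}^{n_i}p_{ij}=1$ and let $\mathbf{x}_i=(x_{i1},\dots,x_{in_i})\in[0,\infty)^{n_i}$. Let $\mathbf{q}=(q_1,\dots,q_k)$ with $q_i>0$ and $\sum_{i=1}^k q_i=1$, and put $\bar{x}=\sum_{i=1}^k q_i\sum_{j=1}^{n_i}p_{ij}x_{ij}$. If there exist real numbers $\tilde{m},\tilde{M}$ such that $\tilde{m}\leq C\big(\sum_{i=1}^k q_ix_{ij_i}\big)\leq\tilde{M}$ for all $j_i\in\{1,\dots,n_i\}$, $i=1,\dots,k$, then $$\mathcal{J}_k(f,\mathbf{p}_1,\dots,\mathbf{p}_k,\mathbf{q},\mathbf{x}_1,\dots,\mathbf{x}_k)\leq\sum_{j_1=1}^{n_1}\cdots\sum_{j_k=1}^{n_k}p_{1j_1}\cdots p_{kj_k}\left(\frac{\tilde{M}-\tilde{m}}{2}\Big|\sum_{i=1}^k q_ix_{ij_i}-\bar{x}\Big|-f\Big(\Big|\sum_{i=1}^k q_ix_{ij_i}-\bar{x}\Big|\Big)\right).$$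
   Context: A function $f:[0,\infty)\to\mathbb{R}$ is superquadratic if for each $x\geq 0$ there exists a real number $C(x)$ such that $f(y)-f(x)\geq f(|y-x|)+C(x)(y-x)$ for all $y\geq 0$. The generalized Jensen functional is defined, for $\mathbf{p}_i,\mathbf{x}_i,\mathbf{q}$ as in the claim, by $$\mathcal{J}_k(f,\mathbf{p}_1,\dots,\mathbf{p}_k,\mathbf{q},\mathbf{x}_1,\dots,\mathbf{x}_k)=\sum_{j_1=1}^{n_1}\cdots\sum_{j_k=1}^{n_k}p_{1j_1}\cdots p_{kj_k}\,f\Big(\sum_{i=1}^k q_ix_{ij_i}\Big)-f\Big(\sum_{i=1}^k q_i\sum_{j=1}^{n_i}p_{ij}x_{ij}\Big).$$ *)

theory Defs
  imports Complex_Main "HOL-Library.FuncSet"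
begin

(* A function on [0,\<infinity>) is represented by a total function on the reals of which
   only the values at nonnegative arguments matter. *)
definition superquadratic :: "(real \<Rightarrow> real) \<Rightarrow> bool" where
  "superquadratic f \<longleftrightarrow>
     (\<forall>x\<ge>0. \<exists>c. \<forall>y\<ge>0. f y - f x \<ge> f \<bar>y - x\<bar> + c * (y - x))"

(* The tuples (j_1,...,j_k) with 1 \<le> j_i \<le> n_i.  Extensionality (PiE) makes each tuple
   occur exactly once, so a sum over this set is the k-fold sum over j_1,...,j_k. *)
definition multi_indices :: "nat \<Rightarrow> (nat \<Rightarrow> nat) \<Rightarrow> (nat \<Rightarrow> nat) set" where
  "multi_indices k n = (\<Pi>\<^sub>E i\<in>{1..k}. {1..n i})"

definition jensen_functional ::
  "nat \<Rightarrow> (nat \<Rightarrow> nat) \<Rightarrow> (real \<Rightarrow> real) \<Rightarrow> (nat \<Rightarrow> nat \<Rightarrow> real) \<Rightarrow> (nat \<Rightarrow> real)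
     \<Rightarrow> (nat \<Rightarrow> nat \<Rightarrow> real) \<Rightarrow> real" where
  "jensen_functional k n f p q x =
     (\<Sum>j\<in>multi_indices k n. (\<Prod>i=1..k. p i (j i)) * f (\<Sum>i=1..k. q i * x i (j i)))
     - f (\<Sum>i=1..k. q i * (\<Sum>j=1..n i. p i j * x i j))"

end

theory Submission
  imports Defs
begin

text \<open>
  Put \<open>Y\<^sub>j = \<Sum>\<^sub>i q\<^sub>i x\<^sub>i(j\<^sub>i)\<close> and
  \<open>P\<^sub>j = \<Prod>\<^sub>i p\<^sub>i(j\<^sub>i)\<close>.  The weights \<open>P\<^sub>j\<close> form a product probability
  distribution on the multi-indices, and the mean of \<open>Y\<close> under it is \<open>xbar\<close>, by linearity and
  because the coordinate \<open>i\<close> has marginal \<open>p\<^sub>i\<close>.  The \<open>k\<close>-fold sum is therefore an ordinary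
  Jensen gap for a single weighted family of points.

  For such a family with mean \<open>a\<close>, the superquadratic inequality is used with the support line
  at the sample point \<open>Y\<^sub>j\<close> and evaluated at \<open>a\<close>, which bounds the gap from above:
  \<open>f Y\<^sub>j - f a \<le> C Y\<^sub>j (Y\<^sub>j - a) - f \<bar>Y\<^sub>j - a\<bar>\<close>.
  The deviations \<open>Y\<^sub>j - a\<close> average to zero, so the slopes may be centred at the midpoint
  \<open>(m + M) / 2\<close> at no cost; the centred slopes have absolute value at most \<open>(M - m) / 2\<close>.
\<close>

text \<open>
  The left-hand side is the covariance of \<open>c\<close> and \<open>y\<close>: the deviations of \<open>y\<close> have mean zero, so
  a common constant can be subtracted from all \<open>c j\<close>.  The midpoint of the range is the constant
  that keeps the largest absolute value smallest.
\<close>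

lemma weighted_slope_deviation_le:
  fixes w y c :: "'a \<Rightarrow> real"
  assumes nonneg: "\<And>j. j \<in> S \<Longrightarrow> 0 \<le> w j"
    and total: "(\<Sum>j\<in>S. w j) = 1"
    and mean: "(\<Sum>j\<in>S. w j * y j) = a"
    and bounds: "\<And>j. j \<in> S \<Longrightarrow> m \<le> c j \<and> c j \<le> M"
  shows "(\<Sum>j\<in>S. w j * (c j * (y j - a))) \<le> (\<Sum>j\<in>S. w j * ((M - m) / 2 * \<bar>y j - a\<bar>))"
proof -
  let ?\<mu> = "(m + M) / 2"
  have "(\<Sum>j\<in>S. w j * (y j - a)) = (\<Sum>j\<in>S. w j * y j) - (\<Sum>j\<in>S. w j) * a"
    by (simp add: right_diff_distrib sum_subtractf sum_distrib_right)
  then have centred: "(\<Sum>j\<in>S. w j * (y j - a)) = 0"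
    by (simp add: total mean)
  have "(\<Sum>j\<in>S. w j * (c j * (y j - a)))
      = (\<Sum>j\<in>S. w j * ((c j - ?\<mu>) * (y j - a)) + ?\<mu> * (w j * (y j - a)))"
    by (intro sum.cong refl) (simp add: field_simps)
  also have "\<dots> = (\<Sum>j\<in>S. w j * ((c j - ?\<mu>) * (y j - a)))"
    by (simp only: sum.distrib sum_distrib_left [symmetric] centred mult_zero_right add_0_right)
  also have "\<dots> \<le> (\<Sum>j\<in>S. w j * ((M - m) / 2 * \<bar>y j - a\<bar>))"
  proof (intro sum_mono mult_left_mono)
    fix j assume j: "j \<in> S"
    have "\<bar>c j - ?\<mu>\<bar> \<le> (M - m) / 2"
      using bounds [OF j] by (auto simp: abs_le_iff field_simps)
    then have "\<bar>c j - ?\<mu>\<bar> * \<bar>y j - a\<bar> \<le> (M - m) / 2 * \<bar>y j - a\<bar>"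
      by (rule mult_right_mono) simp
    then show "(c j - ?\<mu>) * (y j - a) \<le> (M - m) / 2 * \<bar>y j - a\<bar>"
      by (metis abs_ge_self abs_mult order_trans)
  qed (rule nonneg)
  finally show ?thesis .
qed

text \<open>
  Jensen's inequality for superquadratic functions puts the support line at the mean and gives a
  lower bound of the gap; a support line at each sample point \<open>y j\<close> gives this upper bound.
\<close>

lemma superquadratic_jensen_gap_le:
  fixes f C :: "real \<Rightarrow> real" and w y :: "'a \<Rightarrow> real"
  assumes support: "\<And>u v. 0 \<le> u \<Longrightarrow> 0 \<le> v \<Longrightarrow> f v - f u \<ge> f \<bar>v - u\<bar> + C u * (v - u)"
    and nonneg: "\<And>j. j \<in> S \<Longrightarrow> 0 \<le> w j"
    and total: "(\<Sum>j\<in>S. w j) = 1"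
    and points: "\<And>j. j \<in> S \<Longrightarrow> 0 \<le> y j"
    and mean: "(\<Sum>j\<in>S. w j * y j) = a"
    and bounds: "\<And>j. j \<in> S \<Longrightarrow> m \<le> C (y j) \<and> C (y j) \<le> M"
  shows "(\<Sum>j\<in>S. w j * f (y j)) - f a
    \<le> (\<Sum>j\<in>S. w j * ((M - m) / 2 * \<bar>y j - a\<bar> - f \<bar>y j - a\<bar>))"
proof -
  have "0 \<le> a"
    unfolding mean [symmetric] by (intro sum_nonneg mult_nonneg_nonneg nonneg points)
  have "(\<Sum>j\<in>S. w j * f (y j)) - f a = (\<Sum>j\<in>S. w j * f (y j)) - (\<Sum>j\<in>S. w j) * f a"
    by (simp add: total)
  also have "\<dots> = (\<Sum>j\<in>S. w j * (f (y j) - f a))"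
    by (simp add: right_diff_distrib sum_subtractf sum_distrib_right)
  also have "\<dots> \<le> (\<Sum>j\<in>S. w j * (C (y j) * (y j - a) - f \<bar>y j - a\<bar>))"
  proof (intro sum_mono mult_left_mono)
    fix j assume "j \<in> S"
    then have "f a - f (y j) \<ge> f \<bar>a - y j\<bar> + C (y j) * (a - y j)"
      using support points \<open>0 \<le> a\<close> by blast
    then show "f (y j) - f a \<le> C (y j) * (y j - a) - f \<bar>y j - a\<bar>"
      by (simp add: abs_minus_commute algebra_simps)
  qed (rule nonneg)
  also have "\<dots> = (\<Sum>j\<in>S. w j * (C (y j) * (y j - a))) - (\<Sum>j\<in>S. w j * f \<bar>y j - a\<bar>)"
    by (simp add: right_diff_distrib sum_subtractf)
  also have "\<dots> \<le> (\<Sum>j\<in>S. w j * ((M - m) / 2 * \<bar>y j - a\<bar>)) - (\<Sum>j\<in>S. w j * f \<bar>y j - a\<bar>)"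
    by (intro diff_right_mono weighted_slope_deviation_le nonneg total mean bounds)
  also have "\<dots> = (\<Sum>j\<in>S. w j * ((M - m) / 2 * \<bar>y j - a\<bar> - f \<bar>y j - a\<bar>))"
    by (simp add: right_diff_distrib sum_subtractf)
  finally show ?thesis .
qed

lemma sum_product_weights:
  fixes p :: "'i \<Rightarrow> 'a \<Rightarrow> 'b::comm_semiring_1"
  assumes "finite I" and "\<And>i. i \<in> I \<Longrightarrow> finite (A i)"
    and "\<And>i. i \<in> I \<Longrightarrow> (\<Sum>a\<in>A i. p i a) = 1"
  shows "(\<Sum>j\<in>Pi\<^sub>E I A. \<Prod>i\<in>I. p i (j i)) = 1"
  using assms by (simp add: prod_sum_PiE [symmetric])

text \<open>
  The marginals of a product of probability weights are its factors: absorbing \<open>g\<close> into the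
  factor with index \<open>l\<close> leaves a product of independent sums, all of which equal 1 except that
  one.
\<close>

lemma sum_product_weights_marginal:
  fixes p :: "'i \<Rightarrow> 'a \<Rightarrow> 'b::comm_semiring_1"
  assumes fin: "finite I" "\<And>i. i \<in> I \<Longrightarrow> finite (A i)"
    and total: "\<And>i. i \<in> I \<Longrightarrow> (\<Sum>a\<in>A i. p i a) = 1"
    and "l \<in> I"
  shows "(\<Sum>j\<in>Pi\<^sub>E I A. (\<Prod>i\<in>I. p i (j i)) * g (j l)) = (\<Sum>a\<in>A l. p l a * g a)"
proof -
  let ?r = "\<lambda>i a. p i a * (if i = l then g a else 1)"
  have "(\<Sum>j\<in>Pi\<^sub>E I A. (\<Prod>i\<in>I. p i (j i)) * g (j l)) = (\<Sum>j\<in>Pi\<^sub>E I A. \<Prod>i\<in>I. ?r i (j i))"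
    using \<open>l \<in> I\<close> fin by (simp add: prod.distrib)
  also have "\<dots> = (\<Prod>i\<in>I. \<Sum>a\<in>A i. ?r i a)"
    using fin by (rule prod_sum_PiE [symmetric])
  also have "\<dots> = (\<Prod>i\<in>I. if i = l then \<Sum>a\<in>A l. p l a * g a else 1)"
    by (intro prod.cong refl) (simp add: total)
  also have "\<dots> = (\<Sum>a\<in>A l. p l a * g a)"
    using \<open>l \<in> I\<close> fin by simp
  finally show ?thesis .
qed

lemma mean_linear_combination_product_weights:
  fixes p x :: "'i \<Rightarrow> 'a \<Rightarrow> 'b::comm_semiring_1"
  assumes "finite I" "\<And>i. i \<in> I \<Longrightarrow> finite (A i)"
    and "\<And>i. i \<in> I \<Longrightarrow> (\<Sum>a\<in>A i. p i a) = 1"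
  shows "(\<Sum>j\<in>Pi\<^sub>E I A. (\<Prod>i\<in>I. p i (j i)) * (\<Sum>l\<in>I. q l * x l (j l)))
    = (\<Sum>l\<in>I. q l * (\<Sum>a\<in>A l. p l a * x l a))"
proof -
  have "(\<Sum>j\<in>Pi\<^sub>E I A. (\<Prod>i\<in>I. p i (j i)) * (\<Sum>l\<in>I. q l * x l (j l)))
      = (\<Sum>j\<in>Pi\<^sub>E I A. \<Sum>l\<in>I. q l * ((\<Prod>i\<in>I. p i (j i)) * x l (j l)))"
    by (simp add: sum_distrib_left mult.left_commute)
  also have "\<dots> = (\<Sum>l\<in>I. q l * (\<Sum>j\<in>Pi\<^sub>E I A. (\<Prod>i\<in>I. p i (j i)) * x l (j l)))"
    by (subst sum.swap) (simp add: sum_distrib_left)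
  also have "\<dots> = (\<Sum>l\<in>I. q l * (\<Sum>a\<in>A l. p l a * x l a))"
    by (intro sum.cong refl) (simp add: sum_product_weights_marginal assms)
  finally show ?thesis .
qed

theorem proposition3:
  fixes f C :: "real \<Rightarrow> real"
    and k :: nat and n :: "nat \<Rightarrow> nat"
    and p x :: "nat \<Rightarrow> nat \<Rightarrow> real" and q :: "nat \<Rightarrow> real"
    and xbar m M :: real
  assumes "superquadratic f"
    and "\<forall>x\<ge>0. \<forall>y\<ge>0. f y - f x \<ge> f \<bar>y - x\<bar> + C x * (y - x)"
    and "k > 0" and "\<forall>i\<in>{1..k}. n i > 0"
    and "\<forall>i\<in>{1..k}. \<forall>j\<in>{1..n i}. p i j > 0"
    and "\<forall>i\<in>{1..k}. (\<Sum>j=1..n i. p i j) = 1"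
    and "\<forall>i\<in>{1..k}. \<forall>j\<in>{1..n i}. x i j \<ge> 0"
    and "\<forall>i\<in>{1..k}. q i > 0"
    and "(\<Sum>i=1..k. q i) = 1"
    and "xbar = (\<Sum>i=1..k. q i * (\<Sum>j=1..n i. p i j * x i j))"
    and "\<forall>j\<in>multi_indices k n.
           m \<le> C (\<Sum>i=1..k. q i * x i (j i)) \<and> C (\<Sum>i=1..k. q i * x i (j i)) \<le> M"
  shows "jensen_functional k n f p q x
    \<le> (\<Sum>j\<in>multi_indices k n. (\<Prod>i=1..k. p i (j i)) *
         ((M - m) / 2 * \<bar>(\<Sum>i=1..k. q i * x i (j i)) - xbar\<bar>
          - f \<bar>(\<Sum>i=1..k. q i * x i (j i)) - xbar\<bar>))"
proof -
  have coord: "j i \<in> {1..n i}" if "j \<in> multi_indices k n" "i \<in> {1..k}" for i j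
    using that unfolding multi_indices_def by (rule PiE_mem)
  show ?thesis
    unfolding jensen_functional_def assms(10) [symmetric]
  proof (rule superquadratic_jensen_gap_le [where C = C])
    show "f v - f u \<ge> f \<bar>v - u\<bar> + C u * (v - u)" if "0 \<le> u" "0 \<le> v" for u v
      using assms(2) that by blast
    show "0 \<le> (\<Prod>i=1..k. p i (j i))" if "j \<in> multi_indices k n" for j
      using assms(5) coord [OF that] by (intro prod_nonneg) (blast intro: less_imp_le)
    show "(\<Sum>j\<in>multi_indices k n. \<Prod>i=1..k. p i (j i)) = 1"
      unfolding multi_indices_def using assms(6) by (intro sum_product_weights) auto
    show "0 \<le> (\<Sum>i=1..k. q i * x i (j i))" if "j \<in> multi_indices k n" for j
      using assms(7,8) coord [OF that]
      by (intro sum_nonneg mult_nonneg_nonneg) (blast intro: less_imp_le)+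
    show "(\<Sum>j\<in>multi_indices k n. (\<Prod>i=1..k. p i (j i)) * (\<Sum>i=1..k. q i * x i (j i))) = xbar"
      unfolding multi_indices_def assms(10) using assms(6)
      by (intro mean_linear_combination_product_weights) auto
    show "m \<le> C (\<Sum>i=1..k. q i * x i (j i)) \<and> C (\<Sum>i=1..k. q i * x i (j i)) \<le> M"
      if "j \<in> multi_indices k n" for j
      using assms(11) that by blast
  qed
qed

end
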